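(* Let $R\subset S$ be a ring extension of length $2$, i.e. $\ell[R,S]=2$. Then $R\subset S$ is distributive if and only if $|[R,S]|\leq 4$.
   Context: All rings are commutative with unit. $[R,S]$ denotes the set of all $R$-subalgebras of $S$, ordered by inclusion; it is a lattice in which the infimum of $T,U$ is $T\cap U$ and the supremum is the compositum $TU$. The extension $R\subseteq S$ is called distributive if the lattice $[R,S]$ is distributive. The length $\ell[R,S]$ is the supremum of the lengths of chains of elements of $[R,S]$, where a chain $R_0\subset R_1\subset\cdots\subset R_n$ has length $n$. *)

theory Defs
  imports "HOL-Algebra.Algebra" "HOL-Library.Extended_Nat"
begin

text \<open>The extension is presented by its top ring \<open>S\<close> (a ring in the sense of HOL-Algebra) together
  with a subset \<open>R\<close> of its carrier that is a subring. An \<open>R\<close>-subalgebra of \<open>S\<close> is then a unital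
  subring of \<open>S\<close> containing \<open>R\<close>. The library predicate \<^const>\<open>subalgebra\<close> is not this notion: it
  does not require closure under multiplication.\<close>

definition ring_extension :: "'a set \<Rightarrow> ('a, 'b) ring_scheme \<Rightarrow> bool" where
  "ring_extension R S \<longleftrightarrow> cring S \<and> subring R S"

definition intermediate_rings :: "'a set \<Rightarrow> ('a, 'b) ring_scheme \<Rightarrow> 'a set set" where
  "intermediate_rings R S = {T. subring T S \<and> R \<subseteq> T}"

definition intermediate_order :: "'a set \<Rightarrow> ('a, 'b) ring_scheme \<Rightarrow> 'a set gorder" where
  "intermediate_order R S = \<lparr>carrier = intermediate_rings R S, eq = (=), le = (\<subseteq>)\<rparr>"

definition distributive_lattice :: "('a, 'b) gorder_scheme \<Rightarrow> bool" where
  "distributive_lattice L \<longleftrightarrow> lattice L \<and>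
     (\<forall>x \<in> carrier L. \<forall>y \<in> carrier L. \<forall>z \<in> carrier L.
        x \<sqinter>\<^bsub>L\<^esub> (y \<squnion>\<^bsub>L\<^esub> z) = (x \<sqinter>\<^bsub>L\<^esub> y) \<squnion>\<^bsub>L\<^esub> (x \<sqinter>\<^bsub>L\<^esub> z))"

definition distributive_extension :: "'a set \<Rightarrow> ('a, 'b) ring_scheme \<Rightarrow> bool" where
  "distributive_extension R S \<longleftrightarrow> distributive_lattice (intermediate_order R S)"

text \<open>A chain \<open>C 0 \<subset> \<dots> \<subset> C n\<close> has \<open>n + 1\<close> members and length \<open>n\<close>; values of \<open>C\<close> beyond \<open>n\<close>
  are irrelevant.\<close>

definition chain_of_length ::
  "'a set \<Rightarrow> ('a, 'b) ring_scheme \<Rightarrow> (nat \<Rightarrow> 'a set) \<Rightarrow> nat \<Rightarrow> bool" where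
  "chain_of_length R S C n \<longleftrightarrow>
     (\<forall>i\<le>n. C i \<in> intermediate_rings R S) \<and> (\<forall>i<n. C i \<subset> C (Suc i))"

definition ext_length :: "'a set \<Rightarrow> ('a, 'b) ring_scheme \<Rightarrow> enat" where
  "ext_length R S = Sup {enat n | n. \<exists>C. chain_of_length R S C n}"

text \<open>The order above is always a lattice, with intersection as meet and compositum as join.\<close>

lemma intermediate_order_simps [simp]:
  "carrier (intermediate_order R S) = intermediate_rings R S"
  "eq (intermediate_order R S) = (=)"
  "le (intermediate_order R S) = (\<subseteq>)"
  by (simp_all add: intermediate_order_def)

lemma partial_order_intermediate: "partial_order (intermediate_order R S)"
  by unfold_locales auto

lemma intermediate_inter_greatest:
  assumes "ring_extension R S" "T \<in> intermediate_rings R S" "U \<in> intermediate_rings R S"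
  shows "greatest (intermediate_order R S) (T \<inter> U) (Lower (intermediate_order R S) {T, U})"
proof -
  interpret cring S using assms(1) by (simp add: ring_extension_def)
  have "subring (T \<inter> U) S"
    using assms by (intro subring_inter) (auto simp: intermediate_rings_def)
  then show ?thesis
    using assms by (auto simp: greatest_def Lower_def intermediate_rings_def)
qed

lemma intermediate_compositum_least:
  assumes "ring_extension R S" "T \<in> intermediate_rings R S" "U \<in> intermediate_rings R S"
  shows "least (intermediate_order R S) (generate_ring S (T \<union> U))
           (Upper (intermediate_order R S) {T, U})"
proof -
  interpret cring S using assms(1) by (simp add: ring_extension_def)
  have sub: "T \<union> U \<subseteq> carrier S"
    using assms subringE(1) by (auto simp: intermediate_rings_def)
  have min: "generate_ring S (T \<union> U) \<subseteq> V" if "subring V S" "T \<subseteq> V" "U \<subseteq> V" for V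
    using generate_ring_min_subring1[OF sub that(1)] that(2,3) by simp
  show ?thesis
    using assms generate_ring_is_subring[OF sub] min
    by (auto simp: least_def Upper_def intermediate_rings_def intro: generate_ring.incl)
qed

lemma lattice_intermediate:
  assumes "ring_extension R S"
  shows "lattice (intermediate_order R S)"
proof -
  interpret partial_order "intermediate_order R S" by (rule partial_order_intermediate)
  show ?thesis
    using intermediate_inter_greatest[OF assms] intermediate_compositum_least[OF assms]
    by unfold_locales (simp_all, blast+)
qed

lemma meet_intermediate:
  assumes "ring_extension R S" "T \<in> intermediate_rings R S" "U \<in> intermediate_rings R S"
  shows "T \<sqinter>\<^bsub>intermediate_order R S\<^esub> U = T \<inter> U"
proof -
  interpret partial_order "intermediate_order R S" by (rule partial_order_intermediate)
  show ?thesis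
    unfolding meet_def inf_def
    by (rule some_equality, rule intermediate_inter_greatest[OF assms])
      (erule greatest_unique[OF _ intermediate_inter_greatest[OF assms]])
qed

lemma join_intermediate:
  assumes "ring_extension R S" "T \<in> intermediate_rings R S" "U \<in> intermediate_rings R S"
  shows "T \<squnion>\<^bsub>intermediate_order R S\<^esub> U = generate_ring S (T \<union> U)"
proof -
  interpret partial_order "intermediate_order R S" by (rule partial_order_intermediate)
  show ?thesis
    unfolding join_def sup_def
    by (rule some_equality, rule intermediate_compositum_least[OF assms])
      (erule least_unique[OF _ intermediate_compositum_least[OF assms]])
qed

end

theory Submission
  imports Defs
begin

text \<open>
  In a lattice of length \<open>2\<close> every element strictly between bottom and top is both an atom and a
  coatom, so any two distinct such elements are complements of each other. Three of them would form
  a diamond \<open>M\<^sub>3\<close>, which is not distributive: \<open>x \<sqinter> (y \<squnion> z)\<close> is \<open>x\<close>, while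
  \<open>(x \<sqinter> y) \<squnion> (x \<sqinter> z)\<close> is the bottom. Hence distributivity forces at most two proper
  intermediate rings, and with \<open>R\<close> and \<open>S\<close> at most four elements altogether.

  Conversely, distributivity can fail for \<open>x, y, z\<close> only if \<open>y\<close> and \<open>z\<close> are incomparable and
  \<open>x\<close> lies below neither of them. When there are at most four elements, incomparable \<open>y\<close> and
  \<open>z\<close> are the only proper intermediate rings, so such an \<open>x\<close> can only be \<open>S\<close>, and
  for the top element the law is trivial.
\<close>

lemma intermediate_rings_subset_carrier:
  "T \<in> intermediate_rings R S \<Longrightarrow> T \<subseteq> carrier S"
  using subringE(1) by (auto simp: intermediate_rings_def)

lemma base_in_intermediate_rings:
  "ring_extension R S \<Longrightarrow> R \<in> intermediate_rings R S"
  by (simp add: ring_extension_def intermediate_rings_def)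

lemma carrier_in_intermediate_rings:
  assumes "ring_extension R S"
  shows "carrier S \<in> intermediate_rings R S"
proof -
  interpret cring S using assms by (simp add: ring_extension_def)
  show ?thesis
    using assms carrier_is_subring subringE(1)
    by (auto simp: ring_extension_def intermediate_rings_def)
qed

lemma inter_in_intermediate_rings:
  assumes "ring_extension R S" "T \<in> intermediate_rings R S" "U \<in> intermediate_rings R S"
  shows "T \<inter> U \<in> intermediate_rings R S"
  using intermediate_inter_greatest[OF assms] by (simp add: greatest_def Lower_def)

lemma compositum_in_intermediate_rings:
  assumes "ring_extension R S" "T \<in> intermediate_rings R S" "U \<in> intermediate_rings R S"
  shows "generate_ring S (T \<union> U) \<in> intermediate_rings R S"
  using intermediate_compositum_least[OF assms] by (simp add: least_def Upper_def)

lemma compositum_absorb: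
  assumes "ring_extension R S" "T \<in> intermediate_rings R S" "U \<subseteq> T"
  shows "generate_ring S (T \<union> U) = T"
proof
  interpret cring S using assms(1) by (simp add: ring_extension_def)
  show "generate_ring S (T \<union> U) \<subseteq> T"
    using assms generate_ring_min_subring1[of "T \<union> U" T]
      intermediate_rings_subset_carrier[OF assms(2)]
    by (auto simp: intermediate_rings_def)
qed (auto intro: generate_ring.incl)

lemma distributive_extension_iff:
  assumes "ring_extension R S"
  shows "distributive_extension R S \<longleftrightarrow>
    (\<forall>T \<in> intermediate_rings R S. \<forall>U \<in> intermediate_rings R S. \<forall>V \<in> intermediate_rings R S.
       T \<inter> generate_ring S (U \<union> V) = generate_ring S ((T \<inter> U) \<union> (T \<inter> V)))"
  by (simp add: distributive_extension_def distributive_lattice_def assms lattice_intermediate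
      meet_intermediate join_intermediate inter_in_intermediate_rings
      compositum_in_intermediate_rings)

text \<open>The proper intermediate rings form an antichain, since otherwise
  \<open>R \<subset> T \<subset> U \<subset> S\<close> would be a chain of length \<open>3\<close>.\<close>

lemma length_two_no_long_chain:
  assumes ext: "ring_extension R S" and len: "ext_length R S = 2"
    and T: "T \<in> intermediate_rings R S" and U: "U \<in> intermediate_rings R S"
    and "R \<subset> T" "T \<subset> U"
  shows "U = carrier S"
proof (rule ccontr)
  assume "U \<noteq> carrier S"
  then have "U \<subset> carrier S"
    using intermediate_rings_subset_carrier[OF U] by blast
  then have "chain_of_length R S (\<lambda>i. [R, T, U, carrier S] ! i) 3"
    using assms base_in_intermediate_rings[OF ext] carrier_in_intermediate_rings[OF ext]
    by (auto simp: chain_of_length_def numeral_3_eq_3 le_Suc_eq less_Suc_eq)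
  then have "enat 3 \<le> ext_length R S"
    unfolding ext_length_def by (intro Sup_upper) blast
  then show False
    using len by (simp add: numeral_eq_enat)
qed

lemma length_two_complements:
  assumes ext: "ring_extension R S" and len: "ext_length R S = 2"
    and T: "T \<in> intermediate_rings R S - {R, carrier S}"
    and U: "U \<in> intermediate_rings R S - {R, carrier S}"
    and "T \<noteq> U"
  shows "T \<inter> U = R" and "generate_ring S (T \<union> U) = carrier S"
proof -
  have T': "T \<in> intermediate_rings R S" and U': "U \<in> intermediate_rings R S"
    and RT: "R \<subset> T" and RU: "R \<subset> U"
    using T U by (auto simp: intermediate_rings_def)
  have inc: "\<not> T \<subset> U" "\<not> U \<subset> T"
    using length_two_no_long_chain[OF ext len] T U T' U' RT RU by blast+
  show "T \<inter> U = R"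
  proof (rule ccontr)
    assume "T \<inter> U \<noteq> R"
    then have "R \<subset> T \<inter> U" using RT RU by blast
    moreover have "T \<inter> U \<subset> T" using inc \<open>T \<noteq> U\<close> by blast
    ultimately show False
      using length_two_no_long_chain[OF ext len inter_in_intermediate_rings[OF ext T' U'] T'] T
      by blast
  qed
  have "T \<subset> generate_ring S (T \<union> U)"
    using inc \<open>T \<noteq> U\<close> generate_ring.incl[of _ "T \<union> U" S] by blast
  then show "generate_ring S (T \<union> U) = carrier S"
    using length_two_no_long_chain[OF ext len T' compositum_in_intermediate_rings[OF ext T' U'] RT]
    by blast
qed

text \<open>Three distinct proper intermediate rings together with \<open>R\<close> and \<open>S\<close> form the
  diamond \<open>M\<^sub>3\<close>.\<close>

lemma length_two_distributive_not_three:
  assumes ext: "ring_extension R S" and len: "ext_length R S = 2"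
    and distr: "distributive_extension R S"
    and T: "T \<in> intermediate_rings R S - {R, carrier S}"
    and U: "U \<in> intermediate_rings R S - {R, carrier S}"
    and V: "V \<in> intermediate_rings R S - {R, carrier S}"
    and "T \<noteq> U" "T \<noteq> V" "U \<noteq> V"
  shows False
proof -
  note complements = length_two_complements[OF ext len]
  have "T = T \<inter> generate_ring S (U \<union> V)"
    using complements(2)[OF U V \<open>U \<noteq> V\<close>] T intermediate_rings_subset_carrier by blast
  also have "\<dots> = generate_ring S ((T \<inter> U) \<union> (T \<inter> V))"
    using distr T U V unfolding distributive_extension_iff[OF ext] by blast
  also have "\<dots> = R"
    using complements(1)[OF T U \<open>T \<noteq> U\<close>] complements(1)[OF T V \<open>T \<noteq> V\<close>]
      compositum_absorb[OF ext base_in_intermediate_rings[OF ext], of R] by simp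
  finally show False using T by blast
qed

text \<open>A failure of the distributive law at \<open>T, U, V\<close> would make \<open>R, T, U, V, S\<close> five
  distinct rings: \<open>U\<close> and \<open>V\<close> are then incomparable, and \<open>T\<close> is not \<open>S\<close> and lies below
  neither of them.\<close>

lemma distributive_if_at_most_four:
  assumes ext: "ring_extension R S" and "R \<noteq> carrier S"
    and fin: "finite (intermediate_rings R S)" and card: "card (intermediate_rings R S) \<le> 4"
  shows "distributive_extension R S"
  unfolding distributive_extension_iff[OF ext]
proof (intro ballI)
  fix T U V
  assume T: "T \<in> intermediate_rings R S" and U: "U \<in> intermediate_rings R S"
    and V: "V \<in> intermediate_rings R S"
  note absorb = compositum_absorb[OF ext]
  note inter = inter_in_intermediate_rings[OF ext]
  consider "V \<subseteq> U" | "U \<subseteq> V" | "T \<subseteq> U" | "T \<subseteq> V"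
    | "\<not> V \<subseteq> U" "\<not> U \<subseteq> V" "\<not> T \<subseteq> U" "\<not> T \<subseteq> V" by blast
  then show "T \<inter> generate_ring S (U \<union> V) = generate_ring S ((T \<inter> U) \<union> (T \<inter> V))"
  proof cases
    case 1
    then show ?thesis
      using absorb[OF U, of V] absorb[OF inter[OF T U], of "T \<inter> V"] by auto
  next
    case 2
    then show ?thesis
      using absorb[OF V, of U] absorb[OF inter[OF T V], of "T \<inter> U"] by (auto simp: Un_commute)
  next
    case 3
    then have "T \<inter> U = T" "T \<inter> generate_ring S (U \<union> V) = T"
      using generate_ring.incl[of _ "U \<union> V" S] by blast+
    then show ?thesis using absorb[OF T, of "T \<inter> V"] by simp
  next
    case 4
    then have "T \<inter> V = T" "T \<inter> generate_ring S (U \<union> V) = T"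
      using generate_ring.incl[of _ "U \<union> V" S] by blast+
    then show ?thesis using absorb[OF T, of "T \<inter> U"] by (simp add: Un_commute)
  next
    case 5
    have bounds: "R \<subseteq> W" "W \<subseteq> carrier S" if "W \<in> intermediate_rings R S" for W
      using that intermediate_rings_subset_carrier by (auto simp: intermediate_rings_def)
    have "T = carrier S"
    proof (rule ccontr)
      assume "T \<noteq> carrier S"
      then have "distinct [R, T, U, V, carrier S]"
        using 5 \<open>R \<noteq> carrier S\<close> bounds[OF T] bounds[OF U] bounds[OF V] by auto
      then have "card {R, T, U, V, carrier S} = 5"
        using distinct_card[of "[R, T, U, V, carrier S]"] by simp
      moreover have "{R, T, U, V, carrier S} \<subseteq> intermediate_rings R S"
        using T U V base_in_intermediate_rings[OF ext] carrier_in_intermediate_rings[OF ext]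
        by simp
      ultimately have "5 \<le> card (intermediate_rings R S)"
        using card_mono[OF fin] by metis
      then show False using card by simp
    qed
    then show ?thesis
      using bounds(2) U V compositum_in_intermediate_rings[OF ext U V]
      by (simp add: Int_absorb1)
  qed
qed

lemma subset_pair_if_no_three_distinct:
  assumes "\<And>x y z. x \<in> A \<Longrightarrow> y \<in> A \<Longrightarrow> z \<in> A \<Longrightarrow> x \<noteq> y \<Longrightarrow> x \<noteq> z \<Longrightarrow> y \<noteq> z \<Longrightarrow> False"
  obtains u v where "A \<subseteq> {u, v}"
proof (cases "\<exists>u\<in>A. \<exists>v\<in>A. u \<noteq> v")
  case True
  then obtain u v where "u \<in> A" "v \<in> A" "u \<noteq> v" by blast
  then have "A \<subseteq> {u, v}"
    using assms[of _ u v] by (intro subsetI) (simp, metis)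
  then show ?thesis by (rule that)
next
  case False
  then have "A \<subseteq> {SOME x. x \<in> A}"
    by (intro subsetI) (simp, metis someI)
  then show ?thesis using that[of "SOME x. x \<in> A" "SOME x. x \<in> A"] by simp
qed

theorem corollary3p3:
  fixes S :: "('a, 'b) ring_scheme" and R :: "'a set"
  assumes "ring_extension R S" and "R \<subset> carrier S"
    and "ext_length R S = 2"
  shows "distributive_extension R S \<longleftrightarrow>
    finite (intermediate_rings R S) \<and> card (intermediate_rings R S) \<le> 4"
proof
  assume distr: "distributive_extension R S"
  obtain U V where "intermediate_rings R S - {R, carrier S} \<subseteq> {U, V}"
    by (rule subset_pair_if_no_three_distinct,
        rule length_two_distributive_not_three[OF assms(1,3) distr])
  then have "intermediate_rings R S \<subseteq> {R, carrier S, U, V}"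
    by blast
  moreover have "card {R, carrier S, U, V} \<le> 4"
    using card_length[of "[R, carrier S, U, V]"] by simp
  ultimately show "finite (intermediate_rings R S) \<and> card (intermediate_rings R S) \<le> 4"
    by (meson card_mono finite.emptyI finite.insertI finite_subset order_trans)
next
  assume "finite (intermediate_rings R S) \<and> card (intermediate_rings R S) \<le> 4"
  then show "distributive_extension R S"
    using distributive_if_at_most_four[OF assms(1)] assms(2) by blast
qed

end
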